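(* Let $X$ and $Z$ be independent, centered, nondegenerate, infinitely divisible real random variables with finite variances. (1) If the Lévy measure of $Z$ has no positive jumps (i.e. gives zero mass to $(0,\infty)$), then $c_+(X+Z)\le c_+(X)$. (2) If the Lévy measure of $Z$ has no negative jumps (i.e. gives zero mass to $(-\infty,0)$), then $c_-(X+Z)\le c_-(X)$. Suppose in addition that $0<\tau_+(X)<\infty$ and $c_+(X)=1/\tau_+(X)$. Then, under the assumption on $Z$ in part (1), $c_+(X+Z)=c_+(X)$. The reflected statement holds on the left: if $0<\tau_-(X)<\infty$ and $c_-(X)=1/\tau_-(X)$, then, under the assumption on $Z$ in part (2), $c_-(X+Z)=c_-(X)$.
   Context: For a centered, nondegenerate, infinitely divisible random variable $W$ with finite variance $V_W>0$, let $K_W(t)=\log\mathbb{E}e^{tW}\in[0,\infty]$. Define $c_+(W)\in[0,\infty]$ as the infimum of all $c\ge0$ such that $K_W(t)\le\frac{V_Wt^2}{2(1-ct)}$ for every $0\le t<1/c$ (with $1/0=\infty$ and $\inf\emptyset=\infty$), and $c_-(W)=c_+(-W)$. Define $\tau_+(W)=\sup\{t>0:K_W(t)<\infty\}\in[0,\infty]$ (equal to $0$ if the set is empty) and $\tau_-(W)=\tau_+(-W)$. *)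

theory Defs
  imports "HOL-Probability.Probability"
begin

definition nondegenerate :: "'a measure \<Rightarrow> ('a \<Rightarrow> real) \<Rightarrow> bool" where
  "nondegenerate M W \<longleftrightarrow> \<not> (\<exists>a. AE \<omega> in M. W \<omega> = a)"

definition centered :: "'a measure \<Rightarrow> ('a \<Rightarrow> real) \<Rightarrow> bool" where
  "centered M W \<longleftrightarrow> integrable M W \<and> prob_space.expectation M W = 0"

definition infinitely_divisible :: "real measure \<Rightarrow> bool" where
  "infinitely_divisible \<mu> \<longleftrightarrow>
     (\<forall>n\<ge>1. \<exists>\<rho>. real_distribution \<rho> \<and> \<mu> = ((\<lambda>\<eta>. \<rho> \<star> \<eta>) ^^ n) (return borel 0))"

text \<open>
  \<open>\<nu>\<close> is the measure in the Levy--Khintchine representation of \<open>\<mu>\<close>, with truncation at 1.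
  The truncation only affects the drift \<open>b\<close>. The Levy measure of an infinitely divisible
  distribution exists and is unique, so it is rendered as a relation rather than by
  a description operator.
\<close>
definition has_levy_measure :: "real measure \<Rightarrow> real measure \<Rightarrow> bool" where
  "has_levy_measure \<mu> \<nu> \<longleftrightarrow>
     sets \<nu> = sets borel \<and> emeasure \<nu> {0} = 0 \<and>
     (\<integral>\<^sup>+x. ennreal (min 1 (x\<^sup>2)) \<partial>\<nu>) < \<infinity> \<and>
     (\<exists>b v :: real. v \<ge> 0 \<and>
        (\<forall>t. char \<mu> t =
           exp (\<i> * of_real (b * t) - of_real (v * t\<^sup>2 / 2)
                + (CLINT x|\<nu>. iexp (t * x) - 1 - \<i> * of_real (t * x * indicator {-1..1} x)))))"

definition cgf :: "'a measure \<Rightarrow> ('a \<Rightarrow> real) \<Rightarrow> real \<Rightarrow> ereal" where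
  "cgf M W t =
     (let m = (\<integral>\<^sup>+\<omega>. ennreal (exp (t * W \<omega>)) \<partial>M)
      in if m = \<infinity> then \<infinity> else ereal (ln (enn2real m)))"

text \<open>In \<^typ>\<open>ereal\<close>, \<open>1 / 0 = \<infinity>\<close> and \<open>Inf {} = \<infinity>\<close>, as required here.\<close>
definition c_plus :: "'a measure \<Rightarrow> ('a \<Rightarrow> real) \<Rightarrow> ereal" where
  "c_plus M W = Inf (ereal ` {c. 0 \<le> c \<and>
     (\<forall>t. 0 \<le> t \<and> ereal t < 1 / ereal c \<longrightarrow>
        cgf M W t \<le> ereal (prob_space.variance M W * t\<^sup>2 / (2 * (1 - c * t))))})"

definition c_minus :: "'a measure \<Rightarrow> ('a \<Rightarrow> real) \<Rightarrow> ereal" where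
  "c_minus M W = c_plus M (\<lambda>\<omega>. - W \<omega>)"

text \<open>The case split is needed because \<open>Sup {} = -\<infinity>\<close> in \<^typ>\<open>ereal\<close>.\<close>
definition tau_plus :: "'a measure \<Rightarrow> ('a \<Rightarrow> real) \<Rightarrow> ereal" where
  "tau_plus M W =
     (let T = {t. 0 < t \<and> cgf M W t < \<infinity>} in if T = {} then 0 else Sup (ereal ` T))"

definition tau_minus :: "'a measure \<Rightarrow> ('a \<Rightarrow> real) \<Rightarrow> ereal" where
  "tau_minus M W = tau_plus M (\<lambda>\<omega>. - W \<omega>)"

end

(* The point is that a centered infinitely divisible Z with finite variance and no positive jumps
   satisfies K_Z(t) <= V_Z t^2 / 2 for t >= 0.  Adding Z to X then only adds V_Z t^2 / 2, which is
   at most V_Z t^2 / (2 (1 - c t)), so every c admissible for X is admissible for X + Z; conversely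
   K_{X+Z} is infinite wherever K_X is, so no c < 1 / tau_+(X) is admissible for X + Z.

   The bound on K_Z is read off the characteristic function by approximation: cutting the jumps at
   -h leaves a shifted sum of a Gaussian and a compound Poisson variable, whose moment generating
   function is explicit and bounded through e^y <= 1 + y + y^2 / 2 for y <= 0.  As h -> 0 these
   converge weakly to Z by Levy's continuity theorem, and the bound passes to the limit. *)

theory Submission
  imports Defs "HOL-Real_Asymp.Real_Asymp"
begin

subsection \<open>Compound Poisson distributions\<close>

text \<open>The representation of \<open>char\<close> speaks only of real arguments, and it is not
  known beforehand that E exp(t Z) is finite for t > 0, so an imaginary argument cannot simply be
  substituted. Both transforms are therefore computed for approximants where each is elementary, and
  only an upper bound has to survive the limit, for which lower semicontinuity suffices. Cutting at
  -h makes the jump measure finite, its mass being at most \<integral> x^2 / h^2. The shift supplies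
  the compensator of the remaining jumps: it is finite for each h, but may diverge as h tends to 0,
  so it cannot be split off in the limit. The constant V_Z enters through the representation with
  full compensation x instead of the truncated one: its Gaussian part v satisfies v + \<integral>
  x^2 \<le> V_Z, and its drift vanishes. Both facts are extracted from |char(s) - 1| \<le> V_Z s^2 /
  2.\<close>

lemma real_distribution_convolution:
  assumes "real_distribution P" "real_distribution Q"
  shows "real_distribution (P \<star> Q)"
proof -
  interpret P: real_distribution P by fact
  interpret Q: real_distribution Q by fact
  interpret PQ: pair_prob_space P Q ..
  have [measurable]: "(\<lambda>(x, y). x + y) \<in> borel_measurable (P \<Otimes>\<^sub>M Q)" by measurable
  show ?thesis unfolding convolution_def
    by (intro real_distribution.intro real_distribution_axioms.intro PQ.prob_space_distr) auto
qed

lemma char_convolution: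
  assumes "real_distribution P" "real_distribution Q"
  shows "char (P \<star> Q) t = char P t * char Q t"
proof -
  interpret P: real_distribution P by fact
  interpret Q: real_distribution Q by fact
  interpret PQ: pair_prob_space P Q ..
  have [measurable]: "(\<lambda>(x, y). x + y) \<in> borel_measurable (P \<Otimes>\<^sub>M Q)" by measurable
  have int: "integrable (P \<Otimes>\<^sub>M Q) (\<lambda>(x, y). iexp (t * x) * iexp (t * y))"
    by (intro PQ.P.integrable_const_bound[of _ 1]) (auto simp: norm_mult)
  have "char (P \<star> Q) t = (CLINT z|P \<Otimes>\<^sub>M Q. iexp (t * (fst z + snd z)))"
    unfolding char_def convolution_def by (subst integral_distr) (auto simp: case_prod_beta)
  also have "\<dots> = (CLINT z|P \<Otimes>\<^sub>M Q. (case z of (x, y) \<Rightarrow> iexp (t * x) * iexp (t * y)))"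
    by (intro Bochner_Integration.integral_cong refl)
       (auto simp: case_prod_beta distrib_left simp flip: exp_add)
  also have "\<dots> = (CLINT x|P. CLINT y|Q. iexp (t * x) * iexp (t * y))"
    using PQ.integral_fst'[OF int] by simp
  also have "\<dots> = char P t * char Q t"
    by (simp add: char_def)
  finally show ?thesis .
qed

text \<open>Tonelli in the extended nonnegative reals, so that infinite exponential moments are
  covered; the lower bound by 1 / \<tau> relies on that case.\<close>

lemma nn_integral_exp_convolution:
  assumes "real_distribution P" "real_distribution Q"
  shows "(\<integral>\<^sup>+x. ennreal (exp (t * x)) \<partial>(P \<star> Q)) =
    (\<integral>\<^sup>+x. ennreal (exp (t * x)) \<partial>P) * (\<integral>\<^sup>+x. ennreal (exp (t * x)) \<partial>Q)"
proof -
  interpret P: real_distribution P by fact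
  interpret Q: real_distribution Q by fact
  show ?thesis
    by (subst nn_integral_convolution)
       (auto simp: P.finite_measure_axioms Q.finite_measure_axioms distrib_left exp_add
         ennreal_mult nn_integral_cmult nn_integral_multc)
qed

text \<open>With P as the first argument, \<open>convolution_power P\<close> is a kernel on the
  natural numbers, ready to be mixed over a Poisson number of jumps.\<close>

primrec convolution_power :: "real measure \<Rightarrow> nat \<Rightarrow> real measure" where
  "convolution_power P 0 = return borel 0"
| "convolution_power P (Suc n) = (P \<star> convolution_power P n)"

lemma real_distribution_return: "real_distribution (return borel (a::real))"
  by (intro real_distribution.intro real_distribution_axioms.intro prob_space_return) auto

lemma char_return: "char (return borel a) t = iexp (t * a)"
  by (simp add: char_def integral_return)

lemma real_distribution_convolution_power:
  "real_distribution P \<Longrightarrow> real_distribution (convolution_power P n)"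
  by (induction n) (auto intro: real_distribution_convolution real_distribution_return)

lemma char_convolution_power:
  "real_distribution P \<Longrightarrow> char (convolution_power P n) t = char P t ^ n"
  by (induction n)
     (auto simp: char_convolution real_distribution_convolution_power char_return)

lemma nn_integral_exp_convolution_power:
  "real_distribution P \<Longrightarrow> (\<integral>\<^sup>+x. ennreal (exp (t * x)) \<partial>convolution_power P n) =
    (\<integral>\<^sup>+x. ennreal (exp (t * x)) \<partial>P) ^ n"
  by (induction n)
     (auto simp: nn_integral_exp_convolution real_distribution_convolution_power nn_integral_return)

section \<open>Poisson mixtures of convolution powers\<close>

text \<open>The generating function of the Poisson law, summed from the exponential series. The unit
  disc is enough because z will be a value of a characteristic function, and there the constant 1
  dominates the powers.\<close>

lemma integral_poisson:
  fixes z :: complex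
  assumes "0 < rate" "norm z \<le> 1"
  shows "(CLINT n|measure_pmf (poisson_pmf rate). z ^ n) = exp (rate * z - rate)"
proof -
  let ?f = "\<lambda>n. (rate ^ n / fact n * exp (- rate)) *\<^sub>R z ^ n"
  have s: "?f sums exp (rate * z - rate)"
  proof -
    have "(\<lambda>n. exp (- rate) *\<^sub>R ((rate * z) ^ n /\<^sub>R fact n)) sums (exp (- rate) *\<^sub>R exp (rate * z))"
      by (intro sums_scaleR_right exp_converges)
    also have "(\<lambda>n. exp (- rate) *\<^sub>R ((rate * z) ^ n /\<^sub>R fact n)) = ?f"
      by (auto simp: scaleR_conv_of_real power_mult_distrib field_simps)
    also have "exp (- rate) *\<^sub>R exp (rate * z) = exp (rate * z - rate)"
      by (simp add: scaleR_conv_of_real exp_diff exp_minus field_simps exp_of_real flip: of_real_exp)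
    finally show ?thesis .
  qed
  have pmf: "pmf (poisson_pmf rate) n = rate ^ n / fact n * exp (- rate)" for n
    using assms by simp
  have "integrable (measure_pmf (poisson_pmf rate)) (\<lambda>n. z ^ n)"
    by (intro measure_pmf.integrable_const_bound[of _ 1])
       (auto simp: norm_power power_le_one assms)
  then have int: "integrable (count_space UNIV) ?f"
    using assms(1) by (simp add: measure_pmf_eq_density integrable_density pmf)
  have "(CLINT n|measure_pmf (poisson_pmf rate). z ^ n) = (CLINT n|count_space UNIV. ?f n)"
    using assms(1) by (simp add: measure_pmf_eq_density integral_density pmf)
  also have "\<dots> = exp (rate * z - rate)"
    using sums_integral_count_space_nat[OF int] s by (rule sums_unique2)
  finally show ?thesis .
qed

text \<open>The same series with nonnegative terms, so r may exceed 1, as the exponential moment of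
  a jump can.\<close>

lemma nn_integral_poisson:
  assumes "0 < rate" "0 \<le> r"
  shows "(\<integral>\<^sup>+n. ennreal r ^ n \<partial>measure_pmf (poisson_pmf rate)) = ennreal (exp (rate * r - rate))"
proof -
  let ?f = "\<lambda>n. (rate ^ n / fact n * exp (- rate)) * r ^ n"
  have s: "?f sums exp (rate * r - rate)"
  proof -
    have "(\<lambda>n. exp (- rate) * ((rate * r) ^ n /\<^sub>R fact n)) sums (exp (- rate) * exp (rate * r))"
      by (intro sums_mult exp_converges)
    then show ?thesis
      by (simp add: power_mult_distrib field_simps exp_diff exp_minus)
  qed
  have "(\<integral>\<^sup>+n. ennreal r ^ n \<partial>measure_pmf (poisson_pmf rate)) =
      (\<Sum>n. ennreal (pmf (poisson_pmf rate) n) * ennreal r ^ n)"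
    by (simp only: nn_integral_measure_pmf nn_integral_count_space_nat)
  also have "\<dots> = (\<Sum>n. ennreal (?f n))"
  proof (rule suminf_cong)
    fix n
    have "ennreal (?f n) = ennreal (rate ^ n / fact n * exp (- rate)) * ennreal (r ^ n)"
      using assms by (intro ennreal_mult) auto
    then show "ennreal (pmf (poisson_pmf rate) n) * ennreal r ^ n = ennreal (?f n)"
      by (simp only: pmf_poisson[OF assms(1)] ennreal_power[OF assms(2)])
  qed
  also have "\<dots> = ennreal (exp (rate * r - rate))"
    using assms s by (intro suminf_ennreal_eq) auto
  finally show ?thesis .
qed

text \<open>Real and imaginary parts are treated separately by the real-valued
  \<open>integral_bind\<close>; the bound B supplies all integrability. It is used to average
  characteristic functions over a Poisson number of jumps.\<close>

lemma integral_bind_complex: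
  fixes f :: "'a \<Rightarrow> complex"
  assumes [measurable]: "f \<in> borel_measurable K" "N \<in> measurable M (subprob_algebra K)"
    and bound: "\<And>x. norm (f x) \<le> B" and "prob_space M"
  shows "integral\<^sup>L (M \<bind> N) f = (\<integral>x. integral\<^sup>L (N x) f \<partial>M)"
proof -
  interpret prob_space M by fact
  have N: "subprob_space (N x)" "sets (N x) = sets K" if "x \<in> space M" for x
    using measurable_space[OF assms(2) that] by (auto simp: space_subprob_algebra)
  have bd: "AE x in M. emeasure (N x) (space (N x)) \<le> ennreal 1"
    using N by (auto intro!: AE_I2 simp: subprob_space.emeasure_space_le_1)
  interpret MN: subprob_space "M \<bind> N"
    by (rule subprob_space_bind[OF _ assms(2)]) unfold_locales
  have sets_MN [measurable_cong]: "sets (M \<bind> N) = sets K"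
    using sets_bind[OF N(2) not_empty] by simp
  have int: "integrable (M \<bind> N) f"
    using bound by (intro MN.integrable_const_bound[of _ B]) auto
  have int_N: "integrable (N x) f" if "x \<in> space M" for x
  proof -
    interpret subprob_space "N x" using N that by auto
    have [measurable]: "f \<in> borel_measurable (N x)"
      by (simp add: measurable_cong_sets[OF N(2)[OF that] refl])
    show ?thesis using bound by (intro integrable_const_bound[of _ B]) auto
  qed
  have meas: "(\<lambda>x. integral\<^sup>L (N x) f) \<in> borel_measurable M"
    by (rule measurable_compose[OF assms(2) integral_measurable_subprob_algebra]) simp
  have norm_N: "norm (integral\<^sup>L (N x) f) \<le> B" if "x \<in> space M" for x
  proof -
    interpret subprob_space "N x" using N that by auto
    have "norm (integral\<^sup>L (N x) f) \<le> (\<integral>x. B \<partial>N x)"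
      using bound int_N[OF that]
      by (intro order_trans[OF integral_norm_bound] integral_mono) auto
    also have "\<dots> \<le> 1 * B"
      using order_trans[OF norm_ge_zero bound]
      by (simp only: lebesgue_integral_const real_scaleR_def)
        (intro mult_right_mono, auto simp: subprob_measure_le_1)
    finally show ?thesis by simp
  qed
  have int_M: "integrable M (\<lambda>x. integral\<^sup>L (N x) f)"
    using norm_N meas by (intro integrable_const_bound[of _ B]) auto
  show ?thesis
  proof (rule complex_eqI)
    have "Re (integral\<^sup>L (M \<bind> N) f) = integral\<^sup>L (M \<bind> N) (\<lambda>x. Re (f x))"
      using int by simp
    also have "\<dots> = (\<integral>x. integral\<^sup>L (N x) (\<lambda>x. Re (f x)) \<partial>M)"
      by (rule integral_bind[OF _ _ assms(2) _ bd])
         (auto intro: finite_measure_axioms order_trans[OF abs_Re_le_cmod bound])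
    also have "\<dots> = (\<integral>x. Re (integral\<^sup>L (N x) f) \<partial>M)"
      using int_N by (intro Bochner_Integration.integral_cong) auto
    finally show "Re (integral\<^sup>L (M \<bind> N) f) = Re (\<integral>x. integral\<^sup>L (N x) f \<partial>M)"
      using int_M by simp
    have "Im (integral\<^sup>L (M \<bind> N) f) = integral\<^sup>L (M \<bind> N) (\<lambda>x. Im (f x))"
      using int by simp
    also have "\<dots> = (\<integral>x. integral\<^sup>L (N x) (\<lambda>x. Im (f x)) \<partial>M)"
      by (rule integral_bind[OF _ _ assms(2) _ bd])
         (auto intro: finite_measure_axioms order_trans[OF abs_Im_le_cmod bound])
    also have "\<dots> = (\<integral>x. Im (integral\<^sup>L (N x) f) \<partial>M)"
      using int_N by (intro Bochner_Integration.integral_cong) auto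
    finally show "Im (integral\<^sup>L (M \<bind> N) f) = Im (\<integral>x. integral\<^sup>L (N x) f \<partial>M)"
      using int_M by simp
  qed
qed

text \<open>R is the law of a sum of independent jumps with law N / rate, their number being Poisson
  with mean rate = N(UNIV). Averaging z^n over that number gives exp(rate z - rate); taking for z
  either transform of the jump law makes the exponent an integral over N.\<close>

lemma compound_poisson_exists:
  assumes "finite_measure N" and sets_N [measurable_cong]: "sets N = sets borel"
  obtains R where "real_distribution R"
    and "\<And>s. char R s = exp (CLINT x|N. iexp (s * x) - 1)"
    and "\<And>t. integrable N (\<lambda>x. exp (t * x)) \<Longrightarrow>
      (\<integral>\<^sup>+x. ennreal (exp (t * x)) \<partial>R) = ennreal (exp (\<integral>x. exp (t * x) - 1 \<partial>N))"
proof -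
  interpret finite_measure N by fact
  have space_N [simp]: "space N = UNIV" using sets_eq_imp_space_eq[OF sets_N] by simp
  define rate where "rate = measure N UNIV"
  show ?thesis
  proof (cases "rate = 0")
    \<comment> \<open>Nothing can be normalised here: N is the null measure, and the unit mass at 0
      has both transforms equal to exp 0.\<close>
    case True
    then have null: "emeasure N (space N) = 0" by (simp add: rate_def emeasure_eq_measure)
    then have AE: "AE x in N. P x" for P
      by (metis AE_I' null_setsI sets.top subset_UNIV space_N)
    show ?thesis
    proof (rule that[of "return borel 0"])
      have "(CLINT x|N. iexp (s * x) - 1) = (CLINT x|N. 0)" for s
        by (rule integral_cong_AE) (auto intro: AE)
      then show "char (return borel 0) s = exp (CLINT x|N. iexp (s * x) - 1)" for s
        by (simp add: char_return)
      have "(\<integral>x. exp (t * x) - 1 \<partial>N) = (\<integral>x. 0 \<partial>N)" for t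
        by (rule integral_cong_AE) (auto intro: AE)
      then show "(\<integral>\<^sup>+x. ennreal (exp (t * x)) \<partial>return borel 0) =
          ennreal (exp (\<integral>x. exp (t * x) - 1 \<partial>N))" for t
        by (simp add: nn_integral_return)
    qed (rule real_distribution_return)
  next
    case False
    then have rate: "0 < rate" by (simp add: rate_def less_le)
    define P where "P = density N (\<lambda>_. ennreal (1 / rate))"
    have P: "real_distribution P"
    proof (intro real_distribution.intro real_distribution_axioms.intro prob_spaceI)
      have "emeasure P (space P) = ennreal (1 / rate) * ennreal rate"
        by (simp add: P_def emeasure_density nn_integral_cmult rate_def emeasure_eq_measure)
      also have "\<dots> = 1" using rate by (simp flip: ennreal_mult)
      finally show "emeasure P (space P) = 1" .
    qed (simp add: P_def sets_N)
    interpret P: real_distribution P by fact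
    have charP: "rate * char P s - rate = (CLINT x|N. iexp (s * x) - 1)" for s
    proof -
      have "integrable N (\<lambda>x. iexp (s * x))"
        by (intro integrable_const_bound[of _ 1]) auto
      then have "(CLINT x|N. iexp (s * x) - 1) = (CLINT x|N. iexp (s * x)) - rate"
        by (simp add: rate_def of_real_def)
      moreover have "char P s = (CLINT x|N. iexp (s * x)) / rate"
        using rate by (simp add: char_def P_def integral_density scaleR_conv_of_real)
      ultimately show ?thesis using rate by simp
    qed
    define R where "R = measure_pmf (poisson_pmf rate) \<bind> convolution_power P"
    have CP: "real_distribution (convolution_power P n)" for n
      using P by (rule real_distribution_convolution_power)
    have kernel: "convolution_power P \<in> measurable (measure_pmf (poisson_pmf rate)) (subprob_algebra borel)"
      using CP by (auto simp: space_subprob_algebra real_distribution_def real_distribution_axioms_def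
          intro!: prob_space_imp_subprob_space)
    have R: "real_distribution R"
    proof (intro real_distribution.intro real_distribution_axioms.intro)
      show "prob_space R" unfolding R_def
        using CP by (intro measure_pmf.prob_space_bind[OF _ kernel])
          (auto simp: real_distribution_def)
      show "sets R = sets borel" unfolding R_def
        by (rule sets_bind) (use CP in \<open>auto simp: real_distribution.events_eq_borel\<close>)
    qed
    show ?thesis
    proof (rule that[OF R])
      fix s
      have "char R s = (\<integral>n. char (convolution_power P n) s \<partial>measure_pmf (poisson_pmf rate))"
        unfolding char_def R_def
        by (rule integral_bind_complex[OF _ kernel, of _ 1])
           (auto simp: measure_pmf.prob_space_axioms)
      also have "\<dots> = exp (rate * char P s - rate)"
        using P rate by (simp add: char_convolution_power integral_poisson P.cmod_char_le_1)
      finally show "char R s = exp (CLINT x|N. iexp (s * x) - 1)"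
        by (simp only: charP)
    next
      fix t assume int: "integrable N (\<lambda>x. exp (t * x))"
      define r where "r = (\<integral>x. exp (t * x) \<partial>N) / rate"
      have r: "0 \<le> r" using rate by (simp add: r_def)
      have "(\<integral>\<^sup>+x. ennreal (exp (t * x)) \<partial>P) = ennreal (1 / rate) * (\<integral>\<^sup>+x. ennreal (exp (t * x)) \<partial>N)"
        by (simp add: P_def nn_integral_density nn_integral_cmult)
      also have "\<dots> = ennreal r"
        using rate by (subst nn_integral_eq_integral[OF int]) (auto simp: r_def simp flip: ennreal_mult)
      finally have mgfP: "(\<integral>\<^sup>+x. ennreal (exp (t * x)) \<partial>P) = ennreal r" .
      have "(\<integral>\<^sup>+x. ennreal (exp (t * x)) \<partial>R) =
          (\<integral>\<^sup>+n. (\<integral>\<^sup>+x. ennreal (exp (t * x)) \<partial>convolution_power P n) \<partial>measure_pmf (poisson_pmf rate))"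
        unfolding R_def by (rule nn_integral_bind[OF _ kernel]) auto
      also have "\<dots> = ennreal (exp (rate * r - rate))"
        using P r rate by (simp add: nn_integral_exp_convolution_power mgfP nn_integral_poisson)
      also have "rate * r - rate = (\<integral>x. exp (t * x) - 1 \<partial>N)"
        using int rate by (simp add: r_def rate_def)
      finally show "(\<integral>\<^sup>+x. ennreal (exp (t * x)) \<partial>R) =
          ennreal (exp (\<integral>x. exp (t * x) - 1 \<partial>N))" .
    qed
  qed
qed

subsection \<open>Second moment and drift of the Levy measure\<close>

lemma norm_iexp_diff_le: "norm (iexp y - 1 - \<i> * of_real y) \<le> y\<^sup>2 / 2"
  using iexp_approx1[of y 1] by (simp add: algebra_simps numeral_2_eq_2)

text \<open>The right side minus the left is nonincreasing on the whole line and vanishes at 0. For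
  y > 0 the inequality is reversed, which is why the sign of the jumps matters.\<close>

lemma exp_le_quadratic:
  assumes "(y::real) \<le> 0"
  shows "exp y \<le> 1 + y + y\<^sup>2 / 2"
proof -
  have "1 + 0 + 0\<^sup>2 / 2 - exp 0 \<le> 1 + y + y\<^sup>2 / 2 - exp y"
  proof (rule DERIV_nonpos_imp_nonincreasing[OF assms, of "\<lambda>y. 1 + y + y\<^sup>2 / 2 - exp y"])
    fix x :: real
    have "((\<lambda>y. 1 + y + y\<^sup>2 / 2 - exp y) has_real_derivative 1 + x - exp x) (at x)"
      by (auto intro!: derivative_eq_intros)
    then show "\<exists>z. ((\<lambda>y. 1 + y + y\<^sup>2 / 2 - exp y) has_real_derivative z) (at x) \<and> z \<le> 0"
      using exp_ge_add_one_self[of x] by (intro exI[of _ "1 + x - exp x"]) auto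
  qed
  then show ?thesis by simp
qed

text \<open>Because the mean vanishes, the linear Taylor term can be subtracted at no cost, leaving
  only the quadratic remainder.\<close>

lemma (in real_distribution) norm_char_minus_one_le:
  assumes "integrable M (\<lambda>x. x)" "expectation (\<lambda>x. x) = 0" "integrable M (\<lambda>x. x\<^sup>2)"
  shows "norm (char M s - 1) \<le> expectation (\<lambda>x. x\<^sup>2) / 2 * s\<^sup>2"
proof -
  have int: "integrable M (\<lambda>x. iexp (s * x))"
    by (intro integrable_const_bound[of _ 1]) auto
  have int_lin: "integrable M (\<lambda>x. \<i> * of_real (s * x))"
    using assms(1) by (intro integrable_mult_right) (simp del: of_real_mult)
  have "(CLINT x|M. \<i> * of_real (s * x)) = 0"
    using assms(2) by (simp del: of_real_mult)
  then have "char M s - 1 = (CLINT x|M. iexp (s * x) - 1 - \<i> * of_real (s * x))"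
    using int int_lin prob_space unfolding char_def by (simp del: of_real_mult)
  also have "norm \<dots> \<le> (\<integral>x. (s * x)\<^sup>2 / 2 \<partial>M)"
    using int int_lin assms(3)
    by (intro order_trans[OF integral_norm_bound] integral_mono norm_iexp_diff_le)
       (auto simp: power_mult_distrib simp del: of_real_mult)
  also have "\<dots> = expectation (\<lambda>x. x\<^sup>2) / 2 * s\<^sup>2"
    by (simp add: power_mult_distrib)
  finally show ?thesis .
qed

text \<open>The difference quotient is at most C |s|. This turns the quadratic estimates on
  \<open>char\<close> and on the exponent into derivatives at 0, which determine the drift.\<close>

lemma has_vector_derivative_zero_if_quadratic:
  fixes f :: "real \<Rightarrow> 'a::real_normed_vector"
  assumes "\<And>s. norm (f s - f 0) \<le> C * s\<^sup>2"
  shows "(f has_vector_derivative 0) (at 0)"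
proof -
  have "((\<lambda>s. norm (f s - f 0) / norm s) \<longlongrightarrow> 0) (at 0)"
  proof (rule Lim_null_comparison)
    show "\<forall>\<^sub>F s in at 0. norm (norm (f s - f 0) / norm s) \<le> C * \<bar>s\<bar>"
      using assms by (intro always_eventually) (auto simp: divide_le_eq power2_eq_square mult.assoc)
    show "((\<lambda>s. C * \<bar>s\<bar>) \<longlongrightarrow> 0) (at 0)"
      by (intro tendsto_eq_intros) auto
  qed
  then show ?thesis
    by (simp add: has_vector_derivative_def has_derivative_at bounded_linear_zero)
qed

text \<open>Small jumps are controlled by the quadratic Taylor remainder, large ones by the distance
  at most 2 between two points of the unit circle.\<close>

lemma levy_integrand_bound:
  "norm (iexp (t * x) - 1 - \<i> * of_real (t * x * indicator {-1..1} x)) \<le> (2 + t\<^sup>2) * min 1 (x\<^sup>2)"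
proof (cases "x \<in> {-1..1}")
  case True
  have "x\<^sup>2 \<le> 1" using True by (simp add: abs_square_le_1 abs_le_iff)
  have "norm (iexp (t * x) - 1 - \<i> * of_real (t * x)) \<le> (t * x)\<^sup>2 / 2" by (rule norm_iexp_diff_le)
  also have "\<dots> \<le> (2 + t\<^sup>2) * x\<^sup>2"
    by (simp add: power_mult_distrib algebra_simps)
  finally show ?thesis using True \<open>x\<^sup>2 \<le> 1\<close> by simp
next
  case False
  then have "1\<^sup>2 \<le> \<bar>x\<bar>\<^sup>2" by (intro power_mono) auto
  then have "1 \<le> x\<^sup>2" by simp
  have "norm (iexp (t * x) - 1) \<le> 1 + 1"
    by (intro order_trans[OF norm_triangle_ineq4] add_mono) auto
  then have "norm (iexp (t * x) - 1) \<le> 2 + t\<^sup>2"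
    using zero_le_power2[of t] by linarith
  then show ?thesis using False \<open>1 \<le> x\<^sup>2\<close> by (simp add: min_absorb1)
qed

text \<open>With s = 1 / Suc n these are the nonnegative functions 2 (1 - cos(s x)) / s^2, the
  approximants of x^2 to which Fatou's lemma is applied. Evenness of the cosine reduces negative x
  to positive x.\<close>

lemma scaled_one_minus_cos_tendsto:
  "(\<lambda>n. 2 * (1 - cos (x / Suc n)) * (Suc n)\<^sup>2) \<longlonglongrightarrow> (x::real)\<^sup>2"
proof -
  have pos: "(\<lambda>n. 2 * (1 - cos (y / Suc n)) * (Suc n)\<^sup>2) \<longlonglongrightarrow> y\<^sup>2" if "y > 0" for y :: real
    using that unfolding power2_eq_square of_nat_mult by real_asymp
  consider "x = 0" | "x > 0" | "x < 0" by linarith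
  then show ?thesis using pos[of x] pos[of "- x"] by cases simp_all
qed

text \<open>
  The real part of the exponent at \<open>s\<close> is \<open>- s\<^sup>2 / 2 * (v + \<integral>x\<^sup>2)\<close> up to \<open>o(s\<^sup>2)\<close>, so
  Fatou's lemma bounds the second moment of the Levy measure.
\<close>
lemma kolmogorov_representation:
  assumes "real_distribution \<mu>" "has_levy_measure \<mu> \<nu>"
    and moments: "integrable \<mu> (\<lambda>x. x)" "(\<integral>x. x \<partial>\<mu>) = 0" "integrable \<mu> (\<lambda>x. x\<^sup>2)"
  obtains v where "0 \<le> v" "integrable \<nu> (\<lambda>x. x\<^sup>2)"
    and "v + (\<integral>x. x\<^sup>2 \<partial>\<nu>) \<le> (\<integral>x. x\<^sup>2 \<partial>\<mu>)"
    and "\<And>s. char \<mu> s =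
      exp (- of_real (v * s\<^sup>2 / 2) + (CLINT x|\<nu>. iexp (s * x) - 1 - \<i> * of_real (s * x)))"
proof -
  interpret real_distribution \<mu> by fact
  from assms(2) obtain b v where [measurable_cong]: "sets \<nu> = sets borel"
    and fin: "(\<integral>\<^sup>+x. ennreal (min 1 (x\<^sup>2)) \<partial>\<nu>) < \<infinity>" and v: "0 \<le> v"
    and char: "\<And>t. char \<mu> t =
           exp (\<i> * of_real (b * t) - of_real (v * t\<^sup>2 / 2)
                + (CLINT x|\<nu>. iexp (t * x) - 1 - \<i> * of_real (t * x * indicator {-1..1} x)))"
    unfolding has_levy_measure_def by blast
  define V where "V = (\<integral>x. x\<^sup>2 \<partial>\<mu>)"
  have V: "norm (char \<mu> s - 1) \<le> V / 2 * s\<^sup>2" for s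
    using norm_char_minus_one_le[OF moments] by (simp add: V_def)
  have V_nonneg: "0 \<le> V" by (simp add: V_def)
  have int_min: "integrable \<nu> (\<lambda>x. min 1 (x\<^sup>2))"
    using fin by (intro integrableI_nonneg) auto
  have int_trunc: "integrable \<nu> (\<lambda>x. iexp (t * x) - 1 - \<i> * of_real (t * x * indicator {-1..1} x))" for t
    using integrable_mult_right[OF int_min, of "2 + t\<^sup>2"]
    by (rule Bochner_Integration.integrable_bound)
       (auto intro!: AE_I2 order_trans[OF levy_integrand_bound] simp del: of_real_mult)
  have Re_int: "Re (CLINT x|\<nu>. iexp (t * x) - 1 - \<i> * of_real (t * x * indicator {-1..1} x)) =
      (\<integral>x. cos (t * x) - 1 \<partial>\<nu>)" for t
    by (subst integral_Re[OF int_trunc, symmetric]) (simp add: Re_exp)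
  have int_cos: "integrable \<nu> (\<lambda>x. cos (t * x) - 1)" for t
    using integrable_Re[OF int_trunc[of t]] by (simp add: Re_exp)
  \<comment> \<open>Taking the modulus discards the unknown drift and leaves only the Gaussian part
    and a nonnegative integrand.\<close>
  have norm_char: "norm (char \<mu> t) = exp (- (v * t\<^sup>2 / 2 + (\<integral>x. 1 - cos (t * x) \<partial>\<nu>)))" for t
    using int_cos[of t]
    by (simp add: char norm_exp_eq_Re Re_int del: of_real_mult
        flip: Bochner_Integration.integral_minus)

  \<comment> \<open>Put s = 1 / Suc n and u = V s^2 / 2. Then |char(s)| \<ge> 1 - u, and -ln(1 - u)
    \<le> u / (1 - u) once u < 1; multiplying by 2 / s^2 turns the numerator u into V and v s^2 / 2
    into v, which gives \<open>e n\<close>.\<close>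
  define e where "e n = V / (1 - V / 2 * (1 / Suc n)\<^sup>2) - v" for n :: nat
  have vanish: "(\<lambda>n. V / 2 * (1 / Suc n)\<^sup>2) \<longlonglongrightarrow> 0" by real_asymp
  then have e_lim: "e \<longlonglongrightarrow> V - v"
    unfolding e_def
    using tendsto_diff[OF tendsto_divide[OF tendsto_const[of V] tendsto_diff[OF tendsto_const[of 1]]]
        tendsto_const[of v]] by fastforce
  have small: "\<forall>\<^sub>F n in sequentially. V / 2 * (1 / Suc n)\<^sup>2 < 1"
    using vanish by (rule order_tendstoD) simp
  have bound: "\<forall>\<^sub>F n in sequentially. (\<integral>x. 2 * (1 - cos (x / Suc n)) * (Suc n)\<^sup>2 \<partial>\<nu>) \<le> e n"
    using small
  proof eventually_elim
    case (elim n)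
    define s where "s = 1 / real (Suc n)"
    have s: "0 < s" by (simp add: s_def)
    define u where "u = V / 2 * s\<^sup>2"
    have u: "0 \<le> u" "u < 1" using V_nonneg elim by (auto simp: u_def s_def)
    have "1 - norm (char \<mu> s) \<le> norm (1 - char \<mu> s)"
      using norm_triangle_ineq2[of 1 "char \<mu> s"] by simp
    then have "1 - u \<le> norm (char \<mu> s)"
      using V[of s] by (simp add: norm_minus_commute u_def)
    then have "ln (1 - u) \<le> - (v * s\<^sup>2 / 2 + (\<integral>x. 1 - cos (s * x) \<partial>\<nu>))"
      using u by (simp add: norm_char ln_le_cancel_iff flip: ln_exp)
        (metis ln_exp ln_le_cancel_iff exp_gt_zero diff_gt_0_iff_gt)
    moreover have "- ln (1 - u) \<le> u / (1 - u)"
      using ln_le_minus_one[of "1 / (1 - u)"] u by (simp add: ln_div field_simps)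
    ultimately have "(\<integral>x. 1 - cos (s * x) \<partial>\<nu>) \<le> u / (1 - u) - v * s\<^sup>2 / 2"
      by linarith
    then have "2 / s\<^sup>2 * (\<integral>x. 1 - cos (s * x) \<partial>\<nu>) \<le> 2 / s\<^sup>2 * (u / (1 - u) - v * s\<^sup>2 / 2)"
      using s by (intro mult_left_mono) auto
    also have "\<dots> = (2 / s\<^sup>2 * u) / (1 - u) - v"
      using s by (simp add: right_diff_distrib)
    also have "2 / s\<^sup>2 * u = V"
      using s by (simp add: u_def)
    also have "V / (1 - u) - v = e n"
      by (simp only: e_def u_def s_def)
    also have "2 / s\<^sup>2 * (\<integral>x. 1 - cos (s * x) \<partial>\<nu>) = (\<integral>x. 2 * (1 - cos (x / Suc n)) * (Suc n)\<^sup>2 \<partial>\<nu>)"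
      by (subst integral_mult_right_zero[symmetric]) (simp add: s_def field_simps power_divide)
    finally show ?case .
  qed
  have int_scaled: "integrable \<nu> (\<lambda>x. 2 * (1 - cos (x / Suc n)) * (Suc n)\<^sup>2)" for n
    using integrable_mult_right[OF int_cos[of "1 / Suc n"], of "- 2 * (Suc n)\<^sup>2"]
    by (simp add: algebra_simps)
  \<comment> \<open>Since \<open>ennreal\<close> sends negative reals to 0, the Fatou estimate can
    be read back as a real inequality only when V - v is nonnegative.\<close>
  have "0 \<le> V - v"
  proof (rule tendsto_lowerbound[OF e_lim])
    show "\<forall>\<^sub>F n in sequentially. 0 \<le> e n"
      using bound
    proof eventually_elim
      case (elim n)
      have "0 \<le> (\<integral>x. 2 * (1 - cos (x / Suc n)) * (Suc n)\<^sup>2 \<partial>\<nu>)"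
        by (intro Bochner_Integration.integral_nonneg mult_nonneg_nonneg) auto
      then show ?case using elim by (rule order_trans)
    qed
  qed simp
  have "(\<integral>\<^sup>+x. ennreal (x\<^sup>2) \<partial>\<nu>) =
      (\<integral>\<^sup>+x. liminf (\<lambda>n. ennreal (2 * (1 - cos (x / Suc n)) * (Suc n)\<^sup>2)) \<partial>\<nu>)"
    by (intro nn_integral_cong lim_imp_Liminf[symmetric] tendsto_ennrealI
        scaled_one_minus_cos_tendsto) simp
  also have "\<dots> \<le> liminf (\<lambda>n. \<integral>\<^sup>+x. ennreal (2 * (1 - cos (x / Suc n)) * (Suc n)\<^sup>2) \<partial>\<nu>)"
    by (rule nn_integral_liminf) simp
  also have "\<dots> \<le> liminf (\<lambda>n. ennreal (e n))"
  proof (rule Liminf_mono)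
    show "\<forall>\<^sub>F n in sequentially.
        (\<integral>\<^sup>+x. ennreal (2 * (1 - cos (x / Suc n)) * (Suc n)\<^sup>2) \<partial>\<nu>) \<le> ennreal (e n)"
      using bound
    proof eventually_elim
      case (elim n)
      then show ?case
        by (subst nn_integral_eq_integral[OF int_scaled])
           (auto intro: ennreal_leI simp del: of_nat_Suc)
    qed
  qed
  also have "\<dots> = ennreal (V - v)"
    by (intro lim_imp_Liminf tendsto_ennrealI e_lim) simp
  finally have sq_le: "(\<integral>\<^sup>+x. ennreal (x\<^sup>2) \<partial>\<nu>) \<le> ennreal (V - v)" .
  then have int_sq: "integrable \<nu> (\<lambda>x. x\<^sup>2)"
    by (intro integrableI_nonneg) (auto intro: le_less_trans ennreal_less_top)
  have sq_V: "v + (\<integral>x. x\<^sup>2 \<partial>\<nu>) \<le> V"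
    using sq_le \<open>0 \<le> V - v\<close> by (simp add: nn_integral_eq_integral[OF int_sq] ennreal_le_iff)

  \<comment> \<open>\<open>w\<close> is the exponent with full compensation and no drift. The change
    of compensator moves the mean of the jumps outside [-1, 1] into the drift \<open>d\<close>; that
    mean is finite because |x| \<le> x^2 there.\<close>
  define w where "w s = - of_real (v * s\<^sup>2 / 2) +
    (CLINT x|\<nu>. iexp (s * x) - 1 - \<i> * of_real (s * x))" for s
  define d where "d = b + (\<integral>x. x * indicator (- {-1..1}) x \<partial>\<nu>)"
  have int_large: "integrable \<nu> (\<lambda>x. x * indicator (- {-1..1}) x)"
    using int_sq
  proof (rule Bochner_Integration.integrable_bound)
    have "norm (x * indicator (- {-1..1}) x) \<le> norm (x\<^sup>2)" for x :: real
    proof (cases "x \<in> {-1..1}")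
      case False
      then have "1 * \<bar>x\<bar> \<le> \<bar>x\<bar> * \<bar>x\<bar>" by (intro mult_right_mono) auto
      then show ?thesis using False by (simp add: power2_eq_square abs_mult)
    qed simp
    then show "AE x in \<nu>. norm (x * indicator (- {-1..1}) x) \<le> norm (x\<^sup>2)" by simp
  qed simp
  have int_full: "integrable \<nu> (\<lambda>x. iexp (s * x) - 1 - \<i> * of_real (s * x))" for s
    using integrable_mult_right[OF int_sq, of "s\<^sup>2 / 2"]
  proof (rule Bochner_Integration.integrable_bound)
    show "AE x in \<nu>. norm (iexp (s * x) - 1 - \<i> * of_real (s * x)) \<le> norm (s\<^sup>2 / 2 * x\<^sup>2)"
      using norm_iexp_diff_le[of "s * _"]
      by (intro AE_I2) (simp add: power_mult_distrib abs_mult del: of_real_mult)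
  qed simp
  have char_w: "char \<mu> s = exp (\<i> * of_real (s * d)) * exp (w s)" for s
  proof -
    have "(CLINT x|\<nu>. iexp (s * x) - 1 - \<i> * of_real (s * x * indicator {-1..1} x)) =
      (CLINT x|\<nu>. (iexp (s * x) - 1 - \<i> * of_real (s * x)) +
          \<i> * of_real s * of_real (x * indicator (- {-1..1}) x))"
      by (intro Bochner_Integration.integral_cong refl) (auto simp: indicator_def algebra_simps)
    also have "\<dots> = (CLINT x|\<nu>. iexp (s * x) - 1 - \<i> * of_real (s * x)) +
        \<i> * of_real s * of_real (\<integral>x. x * indicator (- {-1..1}) x \<partial>\<nu>)"
      using int_full[of s] int_large
      by (subst Bochner_Integration.integral_add) (auto simp del: of_real_mult)
    finally show ?thesis
      by (simp add: char w_def d_def algebra_simps flip: exp_add)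
  qed
  have w_bound: "norm (w s) \<le> V / 2 * s\<^sup>2" for s
  proof -
    have "norm (CLINT x|\<nu>. iexp (s * x) - 1 - \<i> * of_real (s * x)) \<le> (\<integral>x. (s * x)\<^sup>2 / 2 \<partial>\<nu>)"
      using int_full[of s] int_sq
      by (intro order_trans[OF integral_norm_bound] integral_mono norm_iexp_diff_le)
         (auto simp: power_mult_distrib simp del: of_real_mult)
    also have "\<dots> = (\<integral>x. x\<^sup>2 \<partial>\<nu>) / 2 * s\<^sup>2" by (simp add: power_mult_distrib)
    finally have "norm (w s) \<le> v * s\<^sup>2 / 2 + (\<integral>x. x\<^sup>2 \<partial>\<nu>) / 2 * s\<^sup>2"
      unfolding w_def using v
      by (intro order_trans[OF norm_triangle_ineq] add_mono)
         (simp_all add: norm_mult norm_divide norm_power)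
    also have "\<dots> = (v + (\<integral>x. x\<^sup>2 \<partial>\<nu>)) / 2 * s\<^sup>2" by (simp add: algebra_simps)
    also have "\<dots> \<le> V / 2 * s\<^sup>2" using sq_V by (intro mult_right_mono) auto
    finally show ?thesis .
  qed
  have w0: "w 0 = 0" using w_bound[of 0] by simp
  \<comment> \<open>Both \<open>char \<mu>\<close> and exp(-w) have derivative 0 at 0, hence so does
    their product exp(i s d), whose derivative there is i d. Working with the quotient avoids
    choosing a branch of the logarithm.\<close>
  have "d = 0"
  proof -
    have w_der: "(w has_vector_derivative 0) (at 0)"
      using w_bound by (intro has_vector_derivative_zero_if_quadratic[of _ "V / 2"]) (simp add: w0)
    have char_der: "(char \<mu> has_vector_derivative 0) (at 0)"
      using V by (intro has_vector_derivative_zero_if_quadratic[of _ "V / 2"]) (simp add: char_zero)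
    have "((\<lambda>s. exp (- w s)) has_vector_derivative 0) (at 0)"
      using field_vector_diff_chain_at[of "\<lambda>s. - w s" "-0" 0 exp "exp (- w 0)"] w_der
      by (auto simp: o_def intro!: has_vector_derivative_minus[of w 0, simplified] derivative_eq_intros)
    from has_vector_derivative_mult[OF char_der this]
    have "((\<lambda>s. char \<mu> s * exp (- w s)) has_vector_derivative 0) (at 0)" by simp
    moreover have "(\<lambda>s. char \<mu> s * exp (- w s)) = (\<lambda>s. exp (\<i> * of_real (s * d)))"
      by (simp add: char_w flip: exp_add)
    moreover have "((\<lambda>s. exp (\<i> * of_real (s * d))) has_vector_derivative \<i> * of_real d) (at 0)"
      by (auto intro!: derivative_eq_intros simp: has_vector_derivative_complex_iff Re_exp Im_exp)
    ultimately have "\<i> * of_real d = 0"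
      by (metis vector_derivative_unique_at)
    then show ?thesis by simp
  qed
  show ?thesis
    using v int_sq sq_V char_w \<open>d = 0\<close> by (intro that[of v]) (auto simp: w_def V_def)
qed

subsection \<open>The Gaussian bound without positive jumps\<close>

text \<open>Completing the square: exponential tilting by a turns the standard normal density into
  exp(a^2 / 2) times the normal density with mean a.\<close>

lemma nn_integral_exp_std_normal:
  "(\<integral>\<^sup>+x. ennreal (exp (a * x)) \<partial>std_normal_distribution) = ennreal (exp (a\<^sup>2 / 2))"
proof -
  have "std_normal_density x * exp (a * x) = exp (a\<^sup>2 / 2) * normal_density a 1 x" for x
  proof -
    have "exp (- (x - 0)\<^sup>2 / 2) * exp (a * x) = exp (a\<^sup>2 / 2) * exp (- (x - a)\<^sup>2 / 2)"
      by (simp add: power2_diff field_simps flip: exp_add)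
    then show ?thesis by (simp add: normal_density_def)
  qed
  then have "(\<integral>\<^sup>+x. ennreal (exp (a * x)) \<partial>std_normal_distribution) =
      (\<integral>\<^sup>+x. ennreal (exp (a\<^sup>2 / 2)) * ennreal (normal_density a 1 x) \<partial>lborel)"
    by (subst nn_integral_density) (auto simp flip: ennreal_mult)
  also have "\<dots> = ennreal (exp (a\<^sup>2 / 2))"
    by (simp add: nn_integral_cmult nn_integral_eq_integral)
  finally show ?thesis .
qed

text \<open>Scaling a standard normal variable by sqrt v, rather than using a density of variance v,
  includes the degenerate case v = 0.\<close>

lemma centered_normal_exists:
  assumes "0 \<le> v"
  obtains G where "real_distribution G" "\<And>s. char G s = exp (- of_real (v * s\<^sup>2 / 2))"
    and "\<And>t. (\<integral>\<^sup>+x. ennreal (exp (t * x)) \<partial>G) = ennreal (exp (v * t\<^sup>2 / 2))"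
proof (rule that)
  let ?G = "distr std_normal_distribution borel (\<lambda>x. sqrt v * x)"
  interpret real_distribution std_normal_distribution by (rule real_dist_normal_dist)
  show "real_distribution ?G"
    by (intro real_distribution.intro real_distribution_axioms.intro prob_space_distr) auto
  have "char ?G s = char std_normal_distribution (s * sqrt v)" for s
    unfolding char_def by (subst integral_distr) (auto simp: mult.assoc)
  then show "char ?G s = exp (- of_real (v * s\<^sup>2 / 2))" for s
    using assms by (simp add: char_std_normal_distribution power_mult_distrib mult.commute exp_of_real
      flip: of_real_minus of_real_mult of_real_power of_real_divide)
  have "(t * sqrt v)\<^sup>2 / 2 = v * t\<^sup>2 / 2" for t
    using assms by (simp add: power_mult_distrib)
  moreover have "(\<integral>\<^sup>+x. ennreal (exp (t * x)) \<partial>?G) =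
      (\<integral>\<^sup>+x. ennreal (exp ((t * sqrt v) * x)) \<partial>std_normal_distribution)" for t
    by (subst nn_integral_distr) (auto simp: mult.assoc)
  ultimately show "(\<integral>\<^sup>+x. ennreal (exp (t * x)) \<partial>?G) = ennreal (exp (v * t\<^sup>2 / 2))" for t
    by (simp only: nn_integral_exp_std_normal)
qed

section \<open>Exponential moments under weak limits of truncations\<close>

text \<open>The exponential is unbounded, so weak convergence is applied to the bounded continuous
  functions min(exp(t x), k); monotone convergence in k then recovers the exponential.\<close>

lemma nn_integral_exp_le_of_weak_conv:
  assumes "\<And>n. real_distribution (\<mu> n)" "real_distribution M" "weak_conv_m \<mu> M"
    and bound: "\<And>n. (\<integral>\<^sup>+x. ennreal (exp (t * x)) \<partial>\<mu> n) \<le> ennreal B"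
  shows "(\<integral>\<^sup>+x. ennreal (exp (t * x)) \<partial>M) \<le> ennreal B"
proof -
  interpret M: real_distribution M by fact
  let ?f = "\<lambda>k x. min (exp (t * x)) (real k)"
  have fin: "(\<integral>\<^sup>+x. ennreal (?f k x) \<partial>M) \<le> ennreal B" for k
  proof -
    have lim: "(\<lambda>n. integral\<^sup>L (\<mu> n) (?f k)) \<longlonglongrightarrow> integral\<^sup>L M (?f k)"
      by (rule weak_conv_imp_integral_bdd_continuous_conv[OF assms(1-3), of _ "real k"])
         (auto intro!: continuous_intros)
    have "ennreal (integral\<^sup>L (\<mu> n) (?f k)) \<le> ennreal B" for n
    proof -
      interpret real_distribution "\<mu> n" by fact
      have "integrable (\<mu> n) (?f k)"
        by (intro integrable_const_bound[of _ "real k"]) auto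
      then have "ennreal (integral\<^sup>L (\<mu> n) (?f k)) = (\<integral>\<^sup>+x. ennreal (?f k x) \<partial>\<mu> n)"
        by (intro nn_integral_eq_integral[symmetric]) auto
      also have "\<dots> \<le> (\<integral>\<^sup>+x. ennreal (exp (t * x)) \<partial>\<mu> n)"
        by (intro nn_integral_mono ennreal_leI) auto
      finally show ?thesis using bound order_trans by blast
    qed
    then have "ennreal (integral\<^sup>L M (?f k)) \<le> ennreal B"
      by (intro LIMSEQ_le_const2[OF tendsto_ennrealI[OF lim]]) auto
    moreover have "integrable M (?f k)"
      by (intro M.integrable_const_bound[of _ "real k"]) auto
    ultimately show ?thesis
      by (subst nn_integral_eq_integral) auto
  qed
  have "(\<integral>\<^sup>+x. ennreal (exp (t * x)) \<partial>M) = (\<integral>\<^sup>+x. (SUP k. ennreal (?f k x)) \<partial>M)"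
  proof (intro nn_integral_cong antisym SUP_least)
    fix x
    obtain k where "exp (t * x) \<le> real k" using real_arch_simple by blast
    then show "ennreal (exp (t * x)) \<le> (SUP k. ennreal (?f k x))"
      by (intro SUP_upper2[of k]) auto
  qed (auto intro: ennreal_leI)
  also have "\<dots> = (SUP k. \<integral>\<^sup>+x. ennreal (?f k x) \<partial>M)"
    by (intro nn_integral_monotone_convergence_SUP incseq_SucI le_funI ennreal_leI) auto
  also have "\<dots> \<le> ennreal B"
    by (intro SUP_least fin)
  finally show ?thesis .
qed

text \<open>For x \<le> -h both 1 and |x| are at most a constant times x^2, so the restricted jump
  measure N is finite and has a finite first moment m. Convolving the Gaussian and compound Poisson
  laws with the unit mass at -m replaces iexp(s x) - 1 by its compensated form.\<close>

lemma truncated_approximation_exists: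
  assumes "0 \<le> v" and sets [measurable_cong]: "sets \<nu> = sets borel"
    and int_sq: "integrable \<nu> (\<lambda>x. x\<^sup>2)" and "0 < h"
  obtains R where "real_distribution R"
    and "\<And>s. char R s = exp (- of_real (v * s\<^sup>2 / 2) +
      (CLINT x|\<nu>. indicator {..-h} x *\<^sub>R (iexp (s * x) - 1 - \<i> * of_real (s * x))))"
    and "\<And>t. 0 \<le> t \<Longrightarrow> (\<integral>\<^sup>+x. ennreal (exp (t * x)) \<partial>R) \<le>
      ennreal (exp ((v + (\<integral>x. x\<^sup>2 \<partial>\<nu>)) * t\<^sup>2 / 2))"
proof -
  define N where "N = density \<nu> (\<lambda>x. ennreal (indicator {..-h} x))"
  have int_N: "integral\<^sup>L N f = (\<integral>x. indicator {..-h} x *\<^sub>R f x \<partial>\<nu>)"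
    if "f \<in> borel_measurable borel" for f :: "real \<Rightarrow> 'b::{banach,second_countable_topology}"
    unfolding N_def using that by (subst integral_density) auto
  have sq_ge: "1 \<le> x\<^sup>2 / h\<^sup>2" "\<bar>x\<bar> \<le> x\<^sup>2 / h" if "x \<le> - h" for x
  proof -
    have "h\<^sup>2 \<le> \<bar>x\<bar>\<^sup>2" using that \<open>0 < h\<close> by (intro power_mono) auto
    then show "1 \<le> x\<^sup>2 / h\<^sup>2" using \<open>0 < h\<close> by simp
    have "\<bar>x\<bar> * h \<le> \<bar>x\<bar> * \<bar>x\<bar>" using that \<open>0 < h\<close> by (intro mult_left_mono) auto
    then show "\<bar>x\<bar> \<le> x\<^sup>2 / h" using \<open>0 < h\<close> by (simp add: field_simps power2_eq_square)
  qed
  have integrable_N: "integrable N f"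
    if "f \<in> borel_measurable borel" "\<And>x. x \<le> - h \<Longrightarrow> norm (f x) \<le> C * x\<^sup>2"
    for f :: "real \<Rightarrow> 'b::{banach,second_countable_topology}" and C
  proof -
    have "integrable \<nu> (\<lambda>x. indicator {..-h} x *\<^sub>R f x)"
      using integrable_mult_right[OF int_sq, of "\<bar>C\<bar>"]
    proof (rule Bochner_Integration.integrable_bound)
      show "AE x in \<nu>. norm (indicator {..-h} x *\<^sub>R f x) \<le> norm (\<bar>C\<bar> * x\<^sup>2)"
      proof (rule AE_I2)
        fix x
        show "norm (indicator {..-h} x *\<^sub>R f x) \<le> norm (\<bar>C\<bar> * x\<^sup>2)"
        proof (cases "x \<le> - h")
          case True
          have "C * x\<^sup>2 \<le> \<bar>C\<bar> * x\<^sup>2" by (intro mult_right_mono) auto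
          then show ?thesis using that(2)[OF True] True by (simp add: abs_mult)
        qed simp
      qed
    qed (use that(1) in measurable)
    then show ?thesis
      unfolding N_def using that(1) by (subst integrable_density) auto
  qed
  have sets_N [measurable_cong]: "sets N = sets borel" by (simp add: N_def sets)
  have "integrable N (\<lambda>x. 1 :: real)"
    using sq_ge(1) by (intro integrable_N[of _ "1 / h\<^sup>2"]) auto
  then have "finite_measure N"
    by (intro finite_measureI) (auto simp: integrable_iff_bounded less_top)
  interpret N: finite_measure N by fact
  have int_x: "integrable N (\<lambda>x. x)"
    using sq_ge(2) by (intro integrable_N[of _ "1 / h"]) auto
  have int_iexp: "integrable N (\<lambda>x. iexp (s * x) - 1)" for s
    by (intro Bochner_Integration.integrable_diff N.integrable_const_bound[of _ 1]) auto
  have int_exp: "integrable N (\<lambda>x. exp (t * x))" if "0 \<le> t" for t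
  proof (rule integrable_N[of _ "1 / h\<^sup>2"])
    fix x assume "x \<le> - h"
    then have "t * x \<le> 0" using that \<open>0 < h\<close> by (simp add: mult_nonneg_nonpos)
    then show "norm (exp (t * x)) \<le> 1 / h\<^sup>2 * x\<^sup>2" 
      using sq_ge(1)[OF \<open>x \<le> - h\<close>] order_trans[of "exp (t * x)" 1] by simp
  qed simp
  define m where "m = (\<integral>x. x \<partial>N)"
  obtain P where P: "real_distribution P"
    and char_P: "\<And>s. char P s = exp (CLINT x|N. iexp (s * x) - 1)"
    and mgf_P: "\<And>t. integrable N (\<lambda>x. exp (t * x)) \<Longrightarrow>
      (\<integral>\<^sup>+x. ennreal (exp (t * x)) \<partial>P) = ennreal (exp (\<integral>x. exp (t * x) - 1 \<partial>N))"
    using compound_poisson_exists[OF \<open>finite_measure N\<close> sets_N] by blast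
  obtain G where G: "real_distribution G"
    and char_G: "\<And>s. char G s = exp (- of_real (v * s\<^sup>2 / 2))"
    and mgf_G: "\<And>t. (\<integral>\<^sup>+x. ennreal (exp (t * x)) \<partial>G) = ennreal (exp (v * t\<^sup>2 / 2))"
    using centered_normal_exists[OF \<open>0 \<le> v\<close>] by blast
  have PG: "real_distribution (G \<star> P)" using G P by (rule real_distribution_convolution)
  show ?thesis
  proof (rule that[of "return borel (- m) \<star> (G \<star> P)"])
    show "real_distribution (return borel (- m) \<star> (G \<star> P))"
      by (intro real_distribution_convolution real_distribution_return PG)
  next
    fix s
    have "(CLINT x|\<nu>. indicator {..-h} x *\<^sub>R (iexp (s * x) - 1 - \<i> * of_real (s * x))) =
        (CLINT x|N. (iexp (s * x) - 1) - \<i> * of_real s * of_real x)"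
      by (subst int_N) (auto simp: mult.assoc)
    also have "\<dots> = (CLINT x|N. iexp (s * x) - 1) - \<i> * of_real s * of_real m"
      using int_iexp[of s] int_x by (subst Bochner_Integration.integral_diff) (auto simp: m_def)
    finally have jumps: "(CLINT x|\<nu>. indicator {..-h} x *\<^sub>R (iexp (s * x) - 1 - \<i> * of_real (s * x))) =
        (CLINT x|N. iexp (s * x) - 1) - \<i> * of_real s * of_real m" .
    show "char (return borel (- m) \<star> (G \<star> P)) s = exp (- of_real (v * s\<^sup>2 / 2) +
      (CLINT x|\<nu>. indicator {..-h} x *\<^sub>R (iexp (s * x) - 1 - \<i> * of_real (s * x))))"
      unfolding jumps
      by (simp add: char_convolution real_distribution_return PG G P char_return char_G char_P
          algebra_simps flip: exp_add)
  next
    fix t :: real assume t: "0 \<le> t"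
    have int_sq_N: "integrable N (\<lambda>x. t\<^sup>2 / 2 * x\<^sup>2)"
      by (intro integrable_N[of _ "t\<^sup>2 / 2"]) (auto simp: abs_mult)
    have "(\<integral>x. exp (t * x) - 1 \<partial>N) - t * m = (\<integral>x. exp (t * x) - 1 - t * x \<partial>N)"
      using int_exp[OF t] int_x by (simp add: m_def)
    also have "\<dots> = (\<integral>x. indicator {..-h} x *\<^sub>R (exp (t * x) - 1 - t * x) \<partial>\<nu>)"
      by (rule int_N) simp
    \<comment> \<open>Here t x \<le> 0 on the retained jumps. Elsewhere the left integrand is 0 and
      the right one nonnegative, so the majorant is integrated over all of \<nu> and the bound does
      not depend on h.\<close>
    also have "\<dots> \<le> (\<integral>x. t\<^sup>2 / 2 * x\<^sup>2 \<partial>\<nu>)"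
    proof (rule integral_mono')
      fix x
      show "indicator {..-h} x *\<^sub>R (exp (t * x) - 1 - t * x) \<le> t\<^sup>2 / 2 * x\<^sup>2"
        using exp_le_quadratic[of "t * x"] t \<open>0 < h\<close>
        by (cases "x \<le> - h") (auto simp: power_mult_distrib mult_nonneg_nonpos)
    qed (use int_sq in auto)
    also have "\<dots> = (\<integral>x. x\<^sup>2 \<partial>\<nu>) * t\<^sup>2 / 2" by simp
    finally have le: "(\<integral>x. exp (t * x) - 1 \<partial>N) - t * m \<le> (\<integral>x. x\<^sup>2 \<partial>\<nu>) * t\<^sup>2 / 2" .
    have "(\<integral>\<^sup>+x. ennreal (exp (t * x)) \<partial>(return borel (- m) \<star> (G \<star> P))) =
        ennreal (exp (- t * m)) * (ennreal (exp (v * t\<^sup>2 / 2)) *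
          ennreal (exp (\<integral>x. exp (t * x) - 1 \<partial>N)))"
      by (simp add: nn_integral_exp_convolution real_distribution_return PG G P nn_integral_return
          mgf_G mgf_P[OF int_exp[OF t]])
    also have "\<dots> = ennreal (exp (v * t\<^sup>2 / 2 + ((\<integral>x. exp (t * x) - 1 \<partial>N) - t * m)))"
      by (simp add: algebra_simps flip: ennreal_mult exp_add)
    also have "\<dots> \<le> ennreal (exp ((v + (\<integral>x. x\<^sup>2 \<partial>\<nu>)) * t\<^sup>2 / 2))"
      using le by (intro ennreal_leI) (simp add: algebra_simps add_divide_distrib)
    finally show "(\<integral>\<^sup>+x. ennreal (exp (t * x)) \<partial>(return borel (- m) \<star> (G \<star> P))) \<le>
        ennreal (exp ((v + (\<integral>x. x\<^sup>2 \<partial>\<nu>)) * t\<^sup>2 / 2))" .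
  qed
qed

lemma nn_integral_exp_le_gaussian:
  assumes "real_distribution \<mu>" "has_levy_measure \<mu> \<nu>"
    and moments: "integrable \<mu> (\<lambda>x. x)" "(\<integral>x. x \<partial>\<mu>) = 0" "integrable \<mu> (\<lambda>x. x\<^sup>2)"
    and null: "emeasure \<nu> {0<..} = 0" and "0 \<le> t"
  shows "(\<integral>\<^sup>+x. ennreal (exp (t * x)) \<partial>\<mu>) \<le> ennreal (exp ((\<integral>x. x\<^sup>2 \<partial>\<mu>) * t\<^sup>2 / 2))"
proof -
  obtain v where v: "0 \<le> v" and int_sq: "integrable \<nu> (\<lambda>x. x\<^sup>2)"
    and var: "v + (\<integral>x. x\<^sup>2 \<partial>\<nu>) \<le> (\<integral>x. x\<^sup>2 \<partial>\<mu>)"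
    and char: "\<And>s. char \<mu> s =
      exp (- of_real (v * s\<^sup>2 / 2) + (CLINT x|\<nu>. iexp (s * x) - 1 - \<i> * of_real (s * x)))"
    using kolmogorov_representation[OF assms(1-5)] by blast
  have sets_nu [measurable_cong]: "sets \<nu> = sets borel"
    using assms(2) by (simp add: has_levy_measure_def)
  let ?g = "\<lambda>s x. iexp (s * x) - 1 - \<i> * of_real (s * x)"
  let ?h = "\<lambda>n::nat. 1 / real (Suc n)"
  have "\<exists>R. real_distribution R \<and>
    (\<forall>s. char R s = exp (- of_real (v * s\<^sup>2 / 2) +
      (CLINT x|\<nu>. indicator {..- ?h n} x *\<^sub>R ?g s x))) \<and>
    (\<forall>t\<ge>0. (\<integral>\<^sup>+x. ennreal (exp (t * x)) \<partial>R) \<le>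
      ennreal (exp ((v + (\<integral>x. x\<^sup>2 \<partial>\<nu>)) * t\<^sup>2 / 2)))" for n
    by (rule truncated_approximation_exists[OF v sets_nu int_sq, of "?h n"]) (simp, blast)
  then obtain R where R: "\<And>n. real_distribution (R n)"
    and char_R: "\<And>n s. char (R n) s = exp (- of_real (v * s\<^sup>2 / 2) +
      (CLINT x|\<nu>. indicator {..- ?h n} x *\<^sub>R ?g s x))"
    and mgf_R: "\<And>n t. 0 \<le> t \<Longrightarrow> (\<integral>\<^sup>+x. ennreal (exp (t * x)) \<partial>R n) \<le>
      ennreal (exp ((v + (\<integral>x. x\<^sup>2 \<partial>\<nu>)) * t\<^sup>2 / 2))"
    by metis
  \<comment> \<open>This is what makes the truncations exhaust \<nu>: every x < 0 eventually lies
    below -1 / Suc n, and at x = 0 the integrand is 0. Positive jumps would never be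
    recovered.\<close>
  have AE_nonpos: "AE x in \<nu>. x \<le> 0"
    by (rule AE_I[of _ _ "{0<..}"]) (use null in auto)
  have lim: "(\<lambda>n. char (R n) s) \<longlonglongrightarrow> char \<mu> s" for s
    unfolding char_R char
  proof (intro tendsto_intros integral_dominated_convergence)
    show "integrable \<nu> (\<lambda>x. s\<^sup>2 / 2 * x\<^sup>2)" using int_sq by simp
    show "AE x in \<nu>. norm (indicator {..- ?h n} x *\<^sub>R ?g s x) \<le> s\<^sup>2 / 2 * x\<^sup>2" for n
      using norm_iexp_diff_le[of "s * _"]
      by (intro AE_I2) (auto simp: indicator_def power_mult_distrib simp del: of_real_mult)
    show "AE x in \<nu>. (\<lambda>n. indicator {..- ?h n} x *\<^sub>R ?g s x) \<longlonglongrightarrow> ?g s x"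
      using AE_nonpos
    proof eventually_elim
      case (elim x)
      show ?case
      proof (cases "x = 0")
        case False
        have "?h \<longlonglongrightarrow> 0" by real_asymp
        then have "\<forall>\<^sub>F n in sequentially. ?h n < - x"
          by (rule order_tendstoD) (use elim False in simp)
        then have "\<forall>\<^sub>F n in sequentially. indicator {..- ?h n} x *\<^sub>R ?g s x = ?g s x"
          by eventually_elim (auto simp: indicator_def)
        then show ?thesis by (rule tendsto_eventually)
      qed simp
    qed
  qed simp_all
  have "weak_conv_m R \<mu>"
    using R assms(1) lim by (rule levy_continuity)
  then have "(\<integral>\<^sup>+x. ennreal (exp (t * x)) \<partial>\<mu>) \<le>
      ennreal (exp ((v + (\<integral>x. x\<^sup>2 \<partial>\<nu>)) * t\<^sup>2 / 2))"
    by (rule nn_integral_exp_le_of_weak_conv[of R, OF R assms(1) _ mgf_R[OF \<open>0 \<le> t\<close>]])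
  also have "\<dots> \<le> ennreal (exp ((\<integral>x. x\<^sup>2 \<partial>\<mu>) * t\<^sup>2 / 2))"
    using var by (intro ennreal_leI) (simp add: mult_right_mono)
  finally show ?thesis .
qed

subsection \<open>Left and right scale parameters\<close>

text \<open>Reflection changes the sign of the drift and keeps v; the truncation interval [-1, 1] is
  symmetric, so its indicator is unchanged.\<close>

lemma has_levy_measure_uminus:
  assumes "has_levy_measure \<mu> \<nu>" and [measurable_cong]: "sets \<mu> = sets borel"
  shows "has_levy_measure (distr \<mu> borel uminus) (distr \<nu> borel uminus)"
proof -
  from assms(1) obtain b v where [measurable_cong]: "sets \<nu> = sets borel"
    and zero: "emeasure \<nu> {0} = 0"
    and fin: "(\<integral>\<^sup>+x. ennreal (min 1 (x\<^sup>2)) \<partial>\<nu>) < \<infinity>" and v: "0 \<le> v"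
    and char: "\<And>t. char \<mu> t =
           exp (\<i> * of_real (b * t) - of_real (v * t\<^sup>2 / 2)
                + (CLINT x|\<nu>. iexp (t * x) - 1 - \<i> * of_real (t * x * indicator {-1..1} x)))"
    unfolding has_levy_measure_def by blast
  have space: "space \<nu> = UNIV"
    using sets_eq_imp_space_eq[OF \<open>sets \<nu> = sets borel\<close>] by simp
  have "char (distr \<mu> borel uminus) t =
           exp (\<i> * of_real (- b * t) - of_real (v * t\<^sup>2 / 2)
                + (CLINT x|distr \<nu> borel uminus. iexp (t * x) - 1 - \<i> * of_real (t * x * indicator {-1..1} x)))" for t
  proof -
    have "char (distr \<mu> borel uminus) t = char \<mu> (- t)"
      unfolding char_def by (subst integral_distr) auto
    moreover have "(CLINT x|distr \<nu> borel uminus. iexp (t * x) - 1 - \<i> * of_real (t * x * indicator {-1..1} x)) =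
        (CLINT x|\<nu>. iexp (- t * x) - 1 - \<i> * of_real (- t * x * indicator {-1..1} x))"
    proof (subst integral_distr)
      have "indicator {-1..1} (- x) = (indicator {-1..1} x :: real)" for x :: real
        by (auto simp: indicator_def)
      then show "(CLINT x|\<nu>. iexp (t * - x) - 1 - \<i> * of_real (t * - x * indicator {-1..1} (- x))) =
        (CLINT x|\<nu>. iexp (- t * x) - 1 - \<i> * of_real (- t * x * indicator {-1..1} x))"
        by simp
    qed auto
    ultimately show ?thesis by (simp add: char)
  qed
  moreover have "uminus -` {0} \<inter> space \<nu> = {0 :: real}" by (auto simp: space)
  then have "emeasure (distr \<nu> borel uminus) {0} = 0"
    by (subst emeasure_distr) (auto simp: zero)
  moreover have "(\<integral>\<^sup>+x. ennreal (min 1 (x\<^sup>2)) \<partial>distr \<nu> borel uminus) < \<infinity>"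
    using fin by (subst nn_integral_distr) auto
  ultimately show ?thesis
    unfolding has_levy_measure_def using v
    by (intro conjI exI[of _ "- b"] exI[of _ v]) auto
qed

section \<open>Cumulant generating functions and independent sums\<close>

text \<open>Positivity makes the logarithm in \<open>cgf\<close> genuine and keeps the product with
  an infinite factor infinite.\<close>

lemma (in prob_space) nn_integral_exp_pos:
  assumes [measurable]: "X \<in> borel_measurable M"
  shows "0 < (\<integral>\<^sup>+\<omega>. ennreal (exp (t * X \<omega>)) \<partial>M)"
proof -
  have "\<not> (AE \<omega> in M. False)" by simp
  then show ?thesis
    by (subst zero_less_iff_neq_zero, subst nn_integral_0_iff_AE) auto
qed

text \<open>Moves comparisons from \<open>ereal\<close> to \<open>ennreal\<close>, where
  independence is a product formula. At an infinite moment both sides are false.\<close>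

lemma (in prob_space) cgf_le_iff:
  assumes [measurable]: "X \<in> borel_measurable M"
  shows "cgf M X t \<le> ereal r \<longleftrightarrow> (\<integral>\<^sup>+\<omega>. ennreal (exp (t * X \<omega>)) \<partial>M) \<le> ennreal (exp r)"
proof (cases "(\<integral>\<^sup>+\<omega>. ennreal (exp (t * X \<omega>)) \<partial>M)")
  case (real a)
  then have "0 < a"
    using nn_integral_exp_pos[OF assms, of t] by simp
  then have "ln a \<le> r \<longleftrightarrow> a \<le> exp r"
    by (metis exp_ln exp_le_cancel_iff)
  then show ?thesis using real by (simp add: cgf_def ennreal_le_iff)
qed (simp add: cgf_def top_unique)

lemma (in prob_space) nn_integral_exp_add:
  assumes "indep_var borel X borel Z"
  shows "(\<integral>\<^sup>+\<omega>. ennreal (exp (t * (X \<omega> + Z \<omega>))) \<partial>M) =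
    (\<integral>\<^sup>+\<omega>. ennreal (exp (t * X \<omega>)) \<partial>M) * (\<integral>\<^sup>+\<omega>. ennreal (exp (t * Z \<omega>)) \<partial>M)"
proof -
  have [measurable]: "X \<in> borel_measurable M" "Z \<in> borel_measurable M"
    using assms by (auto dest: indep_var_rv1 indep_var_rv2)
  have distr: "real_distribution (distr M borel Y)" if "Y \<in> borel_measurable M" for Y
    using that by (intro real_distribution.intro real_distribution_axioms.intro prob_space_distr) auto
  have push: "(\<integral>\<^sup>+\<omega>. ennreal (exp (t * Y \<omega>)) \<partial>M) = (\<integral>\<^sup>+x. ennreal (exp (t * x)) \<partial>distr M borel Y)"
    if "Y \<in> borel_measurable M" for Y
    using that by (subst nn_integral_distr) auto
  have "(\<integral>\<^sup>+\<omega>. ennreal (exp (t * (X \<omega> + Z \<omega>))) \<partial>M) =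
      (\<integral>\<^sup>+x. ennreal (exp (t * x)) \<partial>(distr M borel X \<star> distr M borel Z))"
    by (subst push) (simp_all add: sum_indep_random_variable[OF assms])
  also have "\<dots> = (\<integral>\<^sup>+\<omega>. ennreal (exp (t * X \<omega>)) \<partial>M) * (\<integral>\<^sup>+\<omega>. ennreal (exp (t * Z \<omega>)) \<partial>M)"
    by (simp add: nn_integral_exp_convolution distr push)
  finally show ?thesis .
qed

lemma (in prob_space) variance_add_centered:
  assumes "indep_var borel X borel Z" "centered M X" "centered M Z"
    and "integrable M (\<lambda>\<omega>. (X \<omega>)\<^sup>2)" "integrable M (\<lambda>\<omega>. (Z \<omega>)\<^sup>2)"
  shows "variance (\<lambda>\<omega>. X \<omega> + Z \<omega>) = variance X + variance Z"
proof -
  have X: "integrable M X" "expectation X = 0" and Z: "integrable M Z" "expectation Z = 0"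
    using assms by (auto simp: centered_def)
  have XZ: "integrable M (\<lambda>\<omega>. X \<omega> * Z \<omega>)" "expectation (\<lambda>\<omega>. X \<omega> * Z \<omega>) = 0"
    using indep_var_integrable[OF assms(1) X(1) Z(1)]
      indep_var_lebesgue_integral[OF assms(1) X(1) Z(1)] X by simp_all
  then show ?thesis
    using assms(4,5) X Z by (simp add: power2_sum mult.assoc)
qed

lemma (in prob_space) nn_integral_exp_le_variance:
  assumes [measurable]: "Z \<in> borel_measurable M" and "centered M Z" "integrable M (\<lambda>\<omega>. (Z \<omega>)\<^sup>2)"
    and "has_levy_measure (distr M borel Z) \<nu>" "emeasure \<nu> {0<..} = 0" "0 \<le> t"
  shows "(\<integral>\<^sup>+\<omega>. ennreal (exp (t * Z \<omega>)) \<partial>M) \<le> ennreal (exp (variance Z * t\<^sup>2 / 2))"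
proof -
  have "real_distribution (distr M borel Z)"
    by (intro real_distribution.intro real_distribution_axioms.intro prob_space_distr) auto
  from nn_integral_exp_le_gaussian[OF this assms(4) _ _ _ assms(5,6)]
  show ?thesis
    using assms(2,3)
    by (simp add: integrable_distr_eq integral_distr nn_integral_distr centered_def)
qed

section \<open>Upper and lower bounds for the scale parameter of a sum\<close>

lemma (in prob_space) c_plus_add_le:
  assumes indep: "indep_var borel X borel Z" and "centered M X" "centered M Z"
    and "integrable M (\<lambda>\<omega>. (X \<omega>)\<^sup>2)" "integrable M (\<lambda>\<omega>. (Z \<omega>)\<^sup>2)"
    and levy: "has_levy_measure (distr M borel Z) \<nu>" "emeasure \<nu> {0<..} = 0"
  shows "c_plus M (\<lambda>\<omega>. X \<omega> + Z \<omega>) \<le> c_plus M X"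
proof -
  have [measurable]: "X \<in> borel_measurable M" "Z \<in> borel_measurable M"
    using indep by (auto dest: indep_var_rv1 indep_var_rv2)
  show ?thesis
    unfolding c_plus_def
  proof (intro Inf_superset_mono image_mono subsetI CollectI conjI allI impI)
    fix c t
    assume "c \<in> {c. 0 \<le> c \<and> (\<forall>t. 0 \<le> t \<and> ereal t < 1 / ereal c \<longrightarrow>
      cgf M X t \<le> ereal (variance X * t\<^sup>2 / (2 * (1 - c * t))))}"
    then have c: "0 \<le> c" and X_le: "\<And>t. 0 \<le> t \<Longrightarrow> ereal t < 1 / ereal c \<Longrightarrow>
        cgf M X t \<le> ereal (variance X * t\<^sup>2 / (2 * (1 - c * t)))"
      by auto
    show "0 \<le> c" by fact
    assume "0 \<le> t \<and> ereal t < 1 / ereal c"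
    then have t: "0 \<le> t" "ereal t < 1 / ereal c" by auto
    \<comment> \<open>For c = 0 the bound t < 1 / c is vacuous, as 1 / 0 is infinite, and 1 - c t
      equals 1.\<close>
    have ct: "0 < 1 - c * t"
    proof (cases "c = 0")
      case False
      then show ?thesis using c t by (simp add: one_ereal_def field_simps)
    qed simp
    have Z_le: "variance Z * t\<^sup>2 / 2 \<le> variance Z * t\<^sup>2 / (2 * (1 - c * t))"
      using c t(1) ct by (intro divide_left_mono) (auto intro!: mult_nonneg_nonneg)
    have "(\<integral>\<^sup>+\<omega>. ennreal (exp (t * (X \<omega> + Z \<omega>))) \<partial>M) \<le>
        ennreal (exp (variance X * t\<^sup>2 / (2 * (1 - c * t)))) * ennreal (exp (variance Z * t\<^sup>2 / 2))"
      using X_le[OF t] nn_integral_exp_le_variance[OF _ assms(3,5) levy t(1)]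
      by (subst nn_integral_exp_add[OF indep], intro mult_mono) (auto simp: cgf_le_iff)
    also have "\<dots> \<le> ennreal (exp ((variance X + variance Z) * t\<^sup>2 / (2 * (1 - c * t))))"
      using Z_le by (auto simp: add_divide_distrib distrib_right intro!: ennreal_leI
          simp flip: ennreal_mult exp_add)
    finally show "cgf M (\<lambda>\<omega>. X \<omega> + Z \<omega>) t \<le>
        ereal (variance (\<lambda>\<omega>. X \<omega> + Z \<omega>) * t\<^sup>2 / (2 * (1 - c * t)))"
      by (subst cgf_le_iff) (simp_all add: variance_add_centered[OF assms(1-5)])
  qed
qed

lemma (in prob_space) inverse_tau_plus_le_c_plus_add:
  assumes indep: "indep_var borel X borel Z" and "0 < tau_plus M X" "tau_plus M X < \<infinity>"
  shows "1 / tau_plus M X \<le> c_plus M (\<lambda>\<omega>. X \<omega> + Z \<omega>)"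
proof -
  have [measurable]: "X \<in> borel_measurable M" "Z \<in> borel_measurable M"
    using indep by (auto dest: indep_var_rv1 indep_var_rv2)
  obtain T where T: "tau_plus M X = ereal T" "0 < T"
    using assms(2,3) by (cases "tau_plus M X") auto
  have infinite: "(\<integral>\<^sup>+\<omega>. ennreal (exp (t * X \<omega>)) \<partial>M) = \<infinity>" if "T < t" for t
  proof (rule ccontr)
    assume "(\<integral>\<^sup>+\<omega>. ennreal (exp (t * X \<omega>)) \<partial>M) \<noteq> \<infinity>"
    then have "t \<in> {t. 0 < t \<and> cgf M X t < \<infinity>}"
      using that T(2) by (simp add: cgf_def)
    then have "ereal t \<le> tau_plus M X"
      unfolding tau_plus_def Let_def by (auto intro: Sup_upper)
    then show False using that T by simp
  qed
  show ?thesis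
    unfolding c_plus_def
  proof (intro Inf_greatest, elim imageE CollectE conjE, hypsubst, rule ccontr)
    fix c
    assume c: "0 \<le> c" and le: "\<forall>t. 0 \<le> t \<and> ereal t < 1 / ereal c \<longrightarrow>
        cgf M (\<lambda>\<omega>. X \<omega> + Z \<omega>) t \<le> ereal (variance (\<lambda>\<omega>. X \<omega> + Z \<omega>) * t\<^sup>2 / (2 * (1 - c * t)))"
      and "\<not> 1 / tau_plus M X \<le> ereal c"
    then have cT: "c < 1 / T" using T by (simp add: one_ereal_def)
    \<comment> \<open>An admissible c forces finiteness on all of [0, 1 / c), which reaches past T
      when c < 1 / T. For c = 0 this range is the whole half-line, so T + 1 serves.\<close>
    obtain t where t: "T < t" "ereal t < 1 / ereal c"
    proof (cases "c = 0")
      case False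
      then have "T < 1 / c" using cT c T(2) by (simp add: field_simps)
      then obtain t where "T < t" "t < 1 / c" using dense by blast
      then show ?thesis using False by (intro that[of t]) (auto simp: one_ereal_def)
    next
      case True
      then have inf: "1 / ereal c = \<infinity>" by (simp flip: zero_ereal_def)
      show ?thesis by (rule that[of "T + 1"]) (simp_all only: inf, simp_all)
    qed
    have "(\<integral>\<^sup>+\<omega>. ennreal (exp (t * (X \<omega> + Z \<omega>))) \<partial>M) \<le>
        ennreal (exp (variance (\<lambda>\<omega>. X \<omega> + Z \<omega>) * t\<^sup>2 / (2 * (1 - c * t))))"
      using le t T(2) by (subst cgf_le_iff[symmetric]) auto
    \<comment> \<open>In \<open>ennreal\<close> infinity times 0 is 0, so the factor coming from Z
      must be known to be positive.\<close>
    moreover have "(\<integral>\<^sup>+\<omega>. ennreal (exp (t * (X \<omega> + Z \<omega>))) \<partial>M) = \<infinity>"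
      using infinite[OF t(1)] nn_integral_exp_pos[of Z t]
      by (simp add: nn_integral_exp_add[OF indep] ennreal_top_mult)
    ultimately show False by (simp add: top_unique)
  qed
qed

theorem theorem4p3:
  fixes M :: "'a measure" and X Z :: "'a \<Rightarrow> real" and \<nu> :: "real measure"
  assumes "prob_space M"
    and "X \<in> borel_measurable M" and "Z \<in> borel_measurable M"
    and "prob_space.indep_var M borel X borel Z"
    and "centered M X" and "centered M Z"
    and "nondegenerate M X" and "nondegenerate M Z"
    and "infinitely_divisible (distr M borel X)" and "infinitely_divisible (distr M borel Z)"
    and "integrable M (\<lambda>\<omega>. (X \<omega>)\<^sup>2)" and "integrable M (\<lambda>\<omega>. (Z \<omega>)\<^sup>2)"
    and "has_levy_measure (distr M borel Z) \<nu>"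
  shows "(emeasure \<nu> {0<..} = 0 \<longrightarrow> c_plus M (\<lambda>\<omega>. X \<omega> + Z \<omega>) \<le> c_plus M X) \<and>
    (emeasure \<nu> {..<0} = 0 \<longrightarrow> c_minus M (\<lambda>\<omega>. X \<omega> + Z \<omega>) \<le> c_minus M X) \<and>
    (0 < tau_plus M X \<and> tau_plus M X < \<infinity> \<and> c_plus M X = 1 / tau_plus M X \<and>
       emeasure \<nu> {0<..} = 0 \<longrightarrow> c_plus M (\<lambda>\<omega>. X \<omega> + Z \<omega>) = c_plus M X) \<and>
    (0 < tau_minus M X \<and> tau_minus M X < \<infinity> \<and> c_minus M X = 1 / tau_minus M X \<and>
       emeasure \<nu> {..<0} = 0 \<longrightarrow> c_minus M (\<lambda>\<omega>. X \<omega> + Z \<omega>) = c_minus M X)"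
proof -
  interpret prob_space M by fact
  note [measurable] = assms(2,3)
  have sets_nu [measurable_cong]: "sets \<nu> = sets borel"
    using assms(13) by (simp add: has_levy_measure_def)
  have plus: "c_plus M (\<lambda>\<omega>. X \<omega> + Z \<omega>) \<le> c_plus M X" if "emeasure \<nu> {0<..} = 0"
    using assms that by (intro c_plus_add_le) auto
  \<comment> \<open>The left-hand claims are the right-hand ones for -X and -Z, so independence and
    the Levy measure are carried through the reflection.\<close>
  have indep: "indep_var borel (\<lambda>\<omega>. - X \<omega>) borel (\<lambda>\<omega>. - Z \<omega>)"
    using indep_var_compose[OF assms(4), of uminus borel uminus borel] by (simp add: o_def)
  have "distr (distr M borel Z) borel uminus = distr M borel (\<lambda>\<omega>. - Z \<omega>)"
    by (simp add: distr_distr o_def)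
  then have levy: "has_levy_measure (distr M borel (\<lambda>\<omega>. - Z \<omega>)) (distr \<nu> borel uminus)"
    using has_levy_measure_uminus[OF assms(13)] by simp
  have neg: "c_minus M (\<lambda>\<omega>. X \<omega> + Z \<omega>) = c_plus M (\<lambda>\<omega>. - X \<omega> + - Z \<omega>)"
    by (simp add: c_minus_def)
  have minus: "c_minus M (\<lambda>\<omega>. X \<omega> + Z \<omega>) \<le> c_minus M X" if "emeasure \<nu> {..<0} = 0"
  proof -
    have "uminus -` {0<..} \<inter> space \<nu> = {..<0 :: real}"
      using sets_eq_imp_space_eq[OF sets_nu] by auto
    then have "emeasure (distr \<nu> borel uminus) {0<..} = 0"
      using that by (subst emeasure_distr) auto
    then show ?thesis
      unfolding neg unfolding c_minus_def using assms levy indep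
      by (intro c_plus_add_le[of _ _ "distr \<nu> borel uminus"]) (auto simp: centered_def)
  qed
  show ?thesis
    using plus minus inverse_tau_plus_le_c_plus_add[OF assms(4)]
      inverse_tau_plus_le_c_plus_add[OF indep]
    unfolding neg tau_minus_def by (auto intro!: antisym)
qed

end
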